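(* Let $(\mathcal C,U)$ be a UD-category. Then the category $\mathcal C$ is mono-extensive.
   Context: A concrete category over the category $\mathrm{Set}$ of sets is a pair $(\mathcal C,U)$, where $\mathcal C$ is a category and $U:\mathcal C\to \mathrm{Set}$ is a faithful functor. $\mathcal C$ is coproduct complete if it has coproducts of all families of objects; it is balanced if every morphism that is both a monomorphism and an epimorphism is an isomorphism. A subobject of an object $A$ is a pair $(S,\nu)$ with $\nu:S\to A$ a monomorphism. In a coproduct complete category with initial object $\theta\cong\coprod\emptyset$, an object is indecomposable if it is not isomorphic to an initial object nor to a coproduct of two non-initial objects. A concrete category $(\mathcal C,U)$ over $\mathrm{Set}$ is a UD-category if: (UD1) $\mathcal C$ is a coproduct complete balanced category with an initial object $\theta\cong\coprod\emptyset$, for which each morphism $\theta\to A$ is a monomorphism and there is at most one morphism $A\to\theta$, for every object $A$; (UD2) for any morphism $f:A\to B$ there exists a subobject $(A^f,\iota)$ of $B$ such that $U(A^f)=U(f)(U(A))\subseteq U(B)$ and $U(\iota)$ is the subset inclusion map; (UD3) for each morphism $f:A\to B$ and every subobject $(S,\nu)$ of $B$ with $U(f)(U(A))\subseteq U(\nu)(U(S))$ there exists a morphism $g:A\to S$ with $f=\nu g$; (UD4) for every nonempty family $(A_i,\nu_i)_{i\in I}$ of subobjects of an object $A$ there exist subobjects $(\bigcap_i A_i^{\nu_i},\iota_\cap)$ and $(\bigcup_i A_i^{\nu_i},\iota_\cup)$ of $A$ such that $U(\bigcap_i A_i^{\nu_i})=\bigcap_i U(\nu_i)(U(A_i))=\bigcap_i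 U(A_i^{\nu_i})$, $U(\bigcup_i A_i^{\nu_i})=\bigcup_i U(\nu_i)(U(A_i))=\bigcup_i U(A_i^{\nu_i})$ and $U(\iota_\cap),U(\iota_\cup)$ are the subset inclusion maps; (UD5) if $(A,(\nu_0,\nu_1))$ is a coproduct of a pair of objects $(A_0,A_1)$, then $\nu_0,\nu_1$ are monomorphisms and $A_0^{\nu_0}\cap A_1^{\nu_1}$ is isomorphic to $\theta$; (UD6) for every noninitial object $A$ and every $x\in U(A)$ there exists an indecomposable subobject $(B,\nu)$ of $A$ such that $x\in U(\nu)(U(B))$. Mono-extensivity: let $\mathcal M$ be the class of all structural morphisms $\nu_i:A_i\to\coprod_{j} A_j$ of coproducts in $\mathcal C$. A commutative square formed by $\alpha:P\to A$, $\beta:P\to B$, $A\to M$, $B\to M$ is an $\mathcal M$-pull-back if it is a pull-back diagram with $\alpha,\beta\in\mathcal M$. An object $M$ is mono-extensive if (i) for each pair of morphisms $\gamma:A\to M$, $\delta:B\to M$ in $\mathcal M$ there exist an object $P$ and morphisms $\alpha:P\to A$, $\beta:P\to B$ in $\mathcal M$ such that the square $\gamma\alpha=\delta\beta$ is an $\mathcal M$-pull-back; and (ii) in every commutative diagram with bottom row $B_1\to B_1\sqcup B_2\leftarrow B_2$, top row $P_1\to A\leftarrow P_2$ and vertical morphisms $P_1\to B_1$, $A\to B_1\sqcup B_2$, $P_2\to B_2$, where $M\cong B_1\sqcup B_2$, the bottom row is a coproduct diagram and the vertical morphisms belong to $\mathcal M$, the top row is a coproduct diagram if and only if both squares are $\mathcal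 M$-pull-backs. A category is mono-extensive if all its objects are mono-extensive. *)

theory Defs
  imports "HOL-Library.FuncSet"
begin

section \<open>Categories\<close>

record ('o, 'm) cat =
  Obj :: "'o set"
  Arr :: "'m set"
  Dom :: "'m \<Rightarrow> 'o"
  Cod :: "'m \<Rightarrow> 'o"
  Ident :: "'o \<Rightarrow> 'm"
  Comp :: "'m \<Rightarrow> 'm \<Rightarrow> 'm"  (infixr \<open>\<cdot>\<index>\<close> 70)

definition Hom :: "('o, 'm) cat \<Rightarrow> 'o \<Rightarrow> 'o \<Rightarrow> 'm set" where
  "Hom C A B = {f \<in> Arr C. Dom C f = A \<and> Cod C f = B}"

locale category =
  fixes C :: "('o, 'm) cat" (structure)
  assumes Dom_in_Obj: "f \<in> Arr C \<Longrightarrow> Dom C f \<in> Obj C"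
    and Cod_in_Obj: "f \<in> Arr C \<Longrightarrow> Cod C f \<in> Obj C"
    and Ident_in_Hom: "A \<in> Obj C \<Longrightarrow> Ident C A \<in> Hom C A A"
    and Comp_in_Hom: "\<lbrakk>f \<in> Hom C A B; g \<in> Hom C B D\<rbrakk> \<Longrightarrow> g \<cdot> f \<in> Hom C A D"
    and Comp_Ident_right: "f \<in> Hom C A B \<Longrightarrow> f \<cdot> Ident C A = f"
    and Comp_Ident_left: "f \<in> Hom C A B \<Longrightarrow> Ident C B \<cdot> f = f"
    and Comp_assoc: "\<lbrakk>f \<in> Hom C A B; g \<in> Hom C B D; h \<in> Hom C D E\<rbrakk>
          \<Longrightarrow> (h \<cdot> g) \<cdot> f = h \<cdot> (g \<cdot> f)"

definition monic :: "('o, 'm) cat \<Rightarrow> 'm \<Rightarrow> bool" where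
  "monic C f \<longleftrightarrow> f \<in> Arr C \<and>
     (\<forall>X. \<forall>g \<in> Hom C X (Dom C f). \<forall>h \<in> Hom C X (Dom C f).
        f \<cdot>\<^bsub>C\<^esub> g = f \<cdot>\<^bsub>C\<^esub> h \<longrightarrow> g = h)"

definition epic :: "('o, 'm) cat \<Rightarrow> 'm \<Rightarrow> bool" where
  "epic C f \<longleftrightarrow> f \<in> Arr C \<and>
     (\<forall>X. \<forall>g \<in> Hom C (Cod C f) X. \<forall>h \<in> Hom C (Cod C f) X.
        g \<cdot>\<^bsub>C\<^esub> f = h \<cdot>\<^bsub>C\<^esub> f \<longrightarrow> g = h)"

definition invertible :: "('o, 'm) cat \<Rightarrow> 'm \<Rightarrow> bool" where
  "invertible C f \<longleftrightarrow> f \<in> Arr C \<and>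
     (\<exists>g \<in> Hom C (Cod C f) (Dom C f).
        g \<cdot>\<^bsub>C\<^esub> f = Ident C (Dom C f) \<and> f \<cdot>\<^bsub>C\<^esub> g = Ident C (Cod C f))"

definition isomorphic :: "('o, 'm) cat \<Rightarrow> 'o \<Rightarrow> 'o \<Rightarrow> bool" where
  "isomorphic C A B \<longleftrightarrow> (\<exists>f \<in> Hom C A B. invertible C f)"

definition balanced :: "('o, 'm) cat \<Rightarrow> bool" where
  "balanced C \<longleftrightarrow> (\<forall>f. monic C f \<and> epic C f \<longrightarrow> invertible C f)"

definition initial :: "('o, 'm) cat \<Rightarrow> 'o \<Rightarrow> bool" where
  "initial C A \<longleftrightarrow> A \<in> Obj C \<and> (\<forall>B \<in> Obj C. \<exists>!f. f \<in> Hom C A B)"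

definition subobject :: "('o, 'm) cat \<Rightarrow> 'o \<Rightarrow> 'o \<Rightarrow> 'm \<Rightarrow> bool" where
  "subobject C A S \<nu> \<longleftrightarrow> \<nu> \<in> Hom C S A \<and> monic C \<nu>"

definition is_pullback ::
  "('o, 'm) cat \<Rightarrow> 'o \<Rightarrow> 'o \<Rightarrow> 'o \<Rightarrow> 'o \<Rightarrow> 'm \<Rightarrow> 'm \<Rightarrow> 'm \<Rightarrow> 'm \<Rightarrow> bool" where
  "is_pullback C P A B M \<alpha> \<beta> \<gamma> \<delta> \<longleftrightarrow>
     \<alpha> \<in> Hom C P A \<and> \<beta> \<in> Hom C P B \<and> \<gamma> \<in> Hom C A M \<and> \<delta> \<in> Hom C B M \<and>
     \<gamma> \<cdot>\<^bsub>C\<^esub> \<alpha> = \<delta> \<cdot>\<^bsub>C\<^esub> \<beta> \<and>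
     (\<forall>X. \<forall>f \<in> Hom C X A. \<forall>g \<in> Hom C X B. \<gamma> \<cdot>\<^bsub>C\<^esub> f = \<delta> \<cdot>\<^bsub>C\<^esub> g \<longrightarrow>
        (\<exists>!h. h \<in> Hom C X P \<and> \<alpha> \<cdot>\<^bsub>C\<^esub> h = f \<and> \<beta> \<cdot>\<^bsub>C\<^esub> h = g))"

definition is_coproduct ::
  "('o, 'm) cat \<Rightarrow> 'i set \<Rightarrow> ('i \<Rightarrow> 'o) \<Rightarrow> 'o \<Rightarrow> ('i \<Rightarrow> 'm) \<Rightarrow> bool" where
  "is_coproduct C I A Q \<nu> \<longleftrightarrow> Q \<in> Obj C \<and> (\<forall>i \<in> I. \<nu> i \<in> Hom C (A i) Q) \<and>
     (\<forall>X \<in> Obj C. \<forall>f. (\<forall>i \<in> I. f i \<in> Hom C (A i) X) \<longrightarrow>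
        (\<exists>!h. h \<in> Hom C Q X \<and> (\<forall>i \<in> I. h \<cdot>\<^bsub>C\<^esub> \<nu> i = f i)))"

definition binary_coproduct ::
  "('o, 'm) cat \<Rightarrow> 'o \<Rightarrow> 'o \<Rightarrow> 'o \<Rightarrow> 'm \<Rightarrow> 'm \<Rightarrow> bool" where
  "binary_coproduct C A0 A1 Q \<nu>0 \<nu>1 \<longleftrightarrow>
     is_coproduct C (UNIV :: bool set)
       (\<lambda>b. if b then A1 else A0) Q (\<lambda>b. if b then \<nu>1 else \<nu>0)"

definition indecomposable :: "('o, 'm) cat \<Rightarrow> 'o \<Rightarrow> bool" where
  "indecomposable C A \<longleftrightarrow> A \<in> Obj C \<and>
     \<not> (\<exists>\<theta>. initial C \<theta> \<and> isomorphic C A \<theta>) \<and>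
     \<not> (\<exists>B0 B1 Q \<nu>0 \<nu>1. B0 \<in> Obj C \<and> B1 \<in> Obj C \<and> \<not> initial C B0 \<and> \<not> initial C B1 \<and>
          binary_coproduct C B0 B1 Q \<nu>0 \<nu>1 \<and> isomorphic C A Q)"


section \<open>The category of sets and concrete categories\<close>

text \<open>
  The collection \<open>\<S>\<close> consists of the small sets: they are the objects of the category Set and
  the index sets of the families that have to have coproducts. Without such a
  bound, coproduct completeness would be relative to all sets of some type. Closure
  under power sets is not required, so besides the small sets of a universe, all subsets
  of an infinite type qualify too.
\<close>

locale set_universe =
  fixes \<S> :: "'u set set"
  assumes small_subset: "\<lbrakk>X \<in> \<S>; Y \<subseteq> X\<rbrakk> \<Longrightarrow> Y \<in> \<S>"
    and small_image: "X \<in> \<S> \<Longrightarrow> f ` X \<in> \<S>"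
    and small_UN: "\<lbrakk>I \<in> \<S>; \<And>i. i \<in> I \<Longrightarrow> F i \<in> \<S>\<rbrakk> \<Longrightarrow> (\<Union>i\<in>I. F i) \<in> \<S>"
    and small_infinite: "\<exists>X \<in> \<S>. infinite X"

text \<open>A morphism of Set is a triple (domain, extensional function, codomain).\<close>

definition set_cat :: "'u set set \<Rightarrow> ('u set, 'u set \<times> ('u \<Rightarrow> 'u) \<times> 'u set) cat" where
  "set_cat \<S> =
     \<lparr>Obj = \<S>,
      Arr = {(X, f, Y). X \<in> \<S> \<and> Y \<in> \<S> \<and> f \<in> X \<rightarrow>\<^sub>E Y},
      Dom = (\<lambda>(X, f, Y). X),
      Cod = (\<lambda>(X, f, Y). Y),
      Ident = (\<lambda>X. (X, \<lambda>x\<in>X. x, X)),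
      Comp = (\<lambda>(Y', g, Z) (X, f, Y). (X, compose X g f, Z))\<rparr>"

record ('o, 'm, 'p, 'n) cat_map =
  on_obj :: "'o \<Rightarrow> 'p"
  on_arr :: "'m \<Rightarrow> 'n"

locale cat_functor = source: category C + target: category D
  for C :: "('o, 'm) cat" and D :: "('p, 'n) cat" +
  fixes F :: "('o, 'm, 'p, 'n) cat_map"
  assumes on_obj_in_Obj: "A \<in> Obj C \<Longrightarrow> on_obj F A \<in> Obj D"
    and on_arr_in_Hom:
      "f \<in> Hom C A B \<Longrightarrow> on_arr F f \<in> Hom D (on_obj F A) (on_obj F B)"
    and on_arr_Ident: "A \<in> Obj C \<Longrightarrow> on_arr F (Ident C A) = Ident D (on_obj F A)"
    and on_arr_Comp: "\<lbrakk>f \<in> Hom C A B; g \<in> Hom C B E\<rbrakk>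
          \<Longrightarrow> on_arr F (g \<cdot>\<^bsub>C\<^esub> f) = on_arr F g \<cdot>\<^bsub>D\<^esub> on_arr F f"

locale faithful_functor = cat_functor +
  assumes faithful: "\<lbrakk>f \<in> Hom C A B; g \<in> Hom C A B; on_arr F f = on_arr F g\<rbrakk> \<Longrightarrow> f = g"

locale concrete_category =
  set_universe \<S> + faithful_functor C "set_cat \<S>" U
  for \<S> :: "'u set set" and C :: "('o, 'm) cat"
    and U :: "('o, 'm, 'u set, 'u set \<times> ('u \<Rightarrow> 'u) \<times> 'u set) cat_map"

text \<open>The underlying function \<open>U(f)\<close>, without its domain and codomain.\<close>

definition ufun ::
  "('o, 'm, 'u set, 'u set \<times> ('u \<Rightarrow> 'u) \<times> 'u set) cat_map \<Rightarrow> 'm \<Rightarrow> 'u \<Rightarrow> 'u" where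
  "ufun U f = fst (snd (on_arr U f))"

text \<open>
  In the following two definitions, \<open>ufun U (\<nu> i) ` on_obj U (S i)\<close> is also the underlying
  set of the image subobject \<open>(S i)\<^sup>\<nu>\<close> of \<open>\<nu> i\<close>, see the axiom \<open>UD2\<close> below.
\<close>

definition is_intersection ::
  "('o, 'm) cat \<Rightarrow> ('o, 'm, 'u set, 'u set \<times> ('u \<Rightarrow> 'u) \<times> 'u set) cat_map \<Rightarrow> 'o \<Rightarrow>
   'i set \<Rightarrow> ('i \<Rightarrow> 'o) \<Rightarrow> ('i \<Rightarrow> 'm) \<Rightarrow> 'o \<Rightarrow> 'm \<Rightarrow> bool" where
  "is_intersection C U A I S \<nu> P \<iota> \<longleftrightarrow> subobject C A P \<iota> \<and>
     on_obj U P = (\<Inter>i\<in>I. ufun U (\<nu> i) ` on_obj U (S i)) \<and>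
     on_obj U P \<subseteq> on_obj U A \<and> ufun U \<iota> = (\<lambda>x\<in>on_obj U P. x)"

definition is_union ::
  "('o, 'm) cat \<Rightarrow> ('o, 'm, 'u set, 'u set \<times> ('u \<Rightarrow> 'u) \<times> 'u set) cat_map \<Rightarrow> 'o \<Rightarrow>
   'i set \<Rightarrow> ('i \<Rightarrow> 'o) \<Rightarrow> ('i \<Rightarrow> 'm) \<Rightarrow> 'o \<Rightarrow> 'm \<Rightarrow> bool" where
  "is_union C U A I S \<nu> P \<iota> \<longleftrightarrow> subobject C A P \<iota> \<and>
     on_obj U P = (\<Union>i\<in>I. ufun U (\<nu> i) ` on_obj U (S i)) \<and>
     on_obj U P \<subseteq> on_obj U A \<and> ufun U \<iota> = (\<lambda>x\<in>on_obj U P. x)"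


section \<open>UD-categories\<close>

definition coproduct_complete :: "'u set set \<Rightarrow> ('o, 'm) cat \<Rightarrow> bool" where
  "coproduct_complete \<S> C \<longleftrightarrow>
     (\<forall>I \<in> \<S>. \<forall>A. (\<forall>i \<in> I. A i \<in> Obj C) \<longrightarrow> (\<exists>Q \<nu>. is_coproduct C I A Q \<nu>))"

text \<open>
  Initial objects are exactly the coproducts of the empty family and are unique up to
  isomorphism, so the axioms about \<open>\<theta>\<close> are stated for every initial object. In
  \<open>UD5\<close>, intersections are unique up to isomorphism by \<open>UD3\<close> and exist by \<open>UD4\<close>.
\<close>

locale UD_category = concrete_category \<S> C U
  for \<S> :: "'u set set" and C :: "('o, 'm) cat"
    and U :: "('o, 'm, 'u set, 'u set \<times> ('u \<Rightarrow> 'u) \<times> 'u set) cat_map" +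
  assumes UD1_coproducts: "coproduct_complete \<S> C"
    and UD1_balanced: "balanced C"
    and UD1_initial: "\<exists>\<theta>. initial C \<theta>"
    and UD1_from_initial: "\<lbrakk>initial C \<theta>; f \<in> Hom C \<theta> A\<rbrakk> \<Longrightarrow> monic C f"
    and UD1_to_initial: "\<lbrakk>initial C \<theta>; f \<in> Hom C A \<theta>; g \<in> Hom C A \<theta>\<rbrakk> \<Longrightarrow> f = g"
    and UD2: "f \<in> Hom C A B \<Longrightarrow>
      \<exists>S \<iota>. subobject C B S \<iota> \<and> on_obj U S = ufun U f ` on_obj U A \<and>
        ufun U f ` on_obj U A \<subseteq> on_obj U B \<and> ufun U \<iota> = (\<lambda>x\<in>on_obj U S. x)"
    and UD3: "\<lbrakk>f \<in> Hom C A B; subobject C B T \<mu>;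
        ufun U f ` on_obj U A \<subseteq> ufun U \<mu> ` on_obj U T\<rbrakk> \<Longrightarrow>
      \<exists>g \<in> Hom C A T. f = \<mu> \<cdot>\<^bsub>C\<^esub> g"
    and UD4: "\<lbrakk>A \<in> Obj C; I \<in> \<S>; I \<noteq> {}; \<And>i. i \<in> I \<Longrightarrow> subobject C A (S i) (\<nu> i)\<rbrakk> \<Longrightarrow>
      (\<exists>P \<iota>. is_intersection C U A I S \<nu> P \<iota>) \<and> (\<exists>P \<iota>. is_union C U A I S \<nu> P \<iota>)"
    and UD5_monic: "binary_coproduct C A0 A1 A \<nu>0 \<nu>1 \<Longrightarrow> monic C \<nu>0 \<and> monic C \<nu>1"
    and UD5_disjoint: "\<lbrakk>binary_coproduct C A0 A1 A \<nu>0 \<nu>1; initial C \<theta>;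
        is_intersection C U A (UNIV :: bool set)
          (\<lambda>b. if b then A1 else A0) (\<lambda>b. if b then \<nu>1 else \<nu>0) P \<iota>\<rbrakk> \<Longrightarrow>
      isomorphic C P \<theta>"
    and UD6: "\<lbrakk>A \<in> Obj C; \<not> initial C A; x \<in> on_obj U A\<rbrakk> \<Longrightarrow>
      \<exists>B \<nu>. subobject C A B \<nu> \<and> indecomposable C B \<and> x \<in> ufun U \<nu> ` on_obj U B"


section \<open>Mono-extensivity\<close>

definition coproduct_injections :: "'u set set \<Rightarrow> ('o, 'm) cat \<Rightarrow> 'm set" where
  "coproduct_injections \<S> C =
     {m. \<exists>I \<in> \<S>. \<exists>A Q \<nu>. is_coproduct C I A Q \<nu> \<and> (\<exists>i \<in> I. m = \<nu> i)}"

definition M_pullback ::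
  "'u set set \<Rightarrow> ('o, 'm) cat \<Rightarrow> 'o \<Rightarrow> 'o \<Rightarrow> 'o \<Rightarrow> 'o \<Rightarrow> 'm \<Rightarrow> 'm \<Rightarrow> 'm \<Rightarrow> 'm \<Rightarrow> bool" where
  "M_pullback \<S> C P A B M \<alpha> \<beta> \<gamma> \<delta> \<longleftrightarrow> is_pullback C P A B M \<alpha> \<beta> \<gamma> \<delta> \<and>
     \<alpha> \<in> coproduct_injections \<S> C \<and> \<beta> \<in> coproduct_injections \<S> C"

definition mono_extensive_object :: "'u set set \<Rightarrow> ('o, 'm) cat \<Rightarrow> 'o \<Rightarrow> bool" where
  "mono_extensive_object \<S> C M \<longleftrightarrow>
     (\<forall>A B. \<forall>\<gamma> \<in> Hom C A M \<inter> coproduct_injections \<S> C.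
            \<forall>\<delta> \<in> Hom C B M \<inter> coproduct_injections \<S> C.
        \<exists>P \<alpha> \<beta>. M_pullback \<S> C P A B M \<alpha> \<beta> \<gamma> \<delta>) \<and>
     (\<forall>B1 B2 Q \<iota>1 \<iota>2. binary_coproduct C B1 B2 Q \<iota>1 \<iota>2 \<and> isomorphic C M Q \<longrightarrow>
        (\<forall>P1 A P2.
         \<forall>p1 \<in> Hom C P1 A. \<forall>p2 \<in> Hom C P2 A.
         \<forall>v1 \<in> Hom C P1 B1 \<inter> coproduct_injections \<S> C.
         \<forall>v \<in> Hom C A Q \<inter> coproduct_injections \<S> C.
         \<forall>v2 \<in> Hom C P2 B2 \<inter> coproduct_injections \<S> C.
           v \<cdot>\<^bsub>C\<^esub> p1 = \<iota>1 \<cdot>\<^bsub>C\<^esub> v1 \<and> v \<cdot>\<^bsub>C\<^esub> p2 = \<iota>2 \<cdot>\<^bsub>C\<^esub> v2 \<longrightarrow>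
           (binary_coproduct C P1 P2 A p1 p2 \<longleftrightarrow>
              M_pullback \<S> C P1 A B1 Q p1 v1 v \<iota>1 \<and>
              M_pullback \<S> C P2 A B2 Q p2 v2 v \<iota>2)))"

definition mono_extensive :: "'u set set \<Rightarrow> ('o, 'm) cat \<Rightarrow> bool" where
  "mono_extensive \<S> C \<longleftrightarrow> (\<forall>M \<in> Obj C. mono_extensive_object \<S> C M)"

end

theory Submission
  imports Defs
begin

text \<open>
  Everything is read off from underlying sets. By \<open>UD2\<close> and \<open>UD3\<close> a monomorphism is isomorphic to
  the inclusion of its image, so the monomorphisms are the injective morphisms
  (\<open>monic_iff_inj\<close>), and a subobject is determined by the subset that it occupies. As the category
  is balanced, bijective morphisms are isomorphisms (\<open>bij_invertible\<close>).

  The central step is a description of binary coproducts (\<open>binary_coproduct_iff_im\<close>): two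
  monomorphisms into \<open>Q\<close> form a coproduct if and only if their images cover \<open>Q\<close> and meet exactly in
  the image of the initial object. The initial object may have a nonempty underlying set, as it
  does for pointed sets; its image lies in the image of every morphism into \<open>Q\<close>. The images of a
  coproduct cover because their union is a subobject through which both injections factor. For the
  converse, the comparison morphism from a coproduct is surjective, and it is injective because
  points of the two summands can only be identified if they come from one point of the initial
  object, and then they already agree in the coproduct.

  All structural morphisms of coproducts are thus complemented monomorphisms
  (\<open>coproduct_injections_iff\<close>), and a commutative square of monomorphisms is a
  pull-back if and only if its corner contains the intersection of the two images
  (\<open>pullback_iff_im\<close>). With these translations both parts of mono-extensivity
  become distributivity of intersections over unions of subsets: the complement of \<open>A \<inter> B\<close> in \<open>A\<close>
  is \<open>A \<inter> B'\<close>, where \<open>B'\<close> is a complement of \<open>B\<close>.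
\<close>

section \<open>Binary coproducts in a category\<close>

context category
begin

lemma Hom_Obj:
  assumes "f \<in> Hom C A B"
  shows "A \<in> Obj C" "B \<in> Obj C"
  using assms Dom_in_Obj Cod_in_Obj unfolding Hom_def by auto

lemma Dom_Hom: "f \<in> Hom C A B \<Longrightarrow> Dom C f = A"
  and Cod_Hom: "f \<in> Hom C A B \<Longrightarrow> Cod C f = B"
  and Arr_Hom: "f \<in> Hom C A B \<Longrightarrow> f \<in> Arr C"
  by (auto simp: Hom_def)

lemma monicD:
  assumes "monic C f" "f \<in> Hom C A B" "g \<in> Hom C X A" "h \<in> Hom C X A" "f \<cdot> g = f \<cdot> h"
  shows "g = h"
  using assms unfolding monic_def by (auto simp: Dom_Hom)

lemma subobjectI: "f \<in> Hom C A B \<Longrightarrow> monic C f \<Longrightarrow> subobject C B A f"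
  by (simp add: subobject_def)

lemma invertibleE:
  assumes "invertible C k" "k \<in> Hom C A B"
  obtains k' where "k' \<in> Hom C B A" "k' \<cdot> k = Ident C A" "k \<cdot> k' = Ident C B"
  using assms unfolding invertible_def by (auto simp: Dom_Hom Cod_Hom)

lemma initial_Hom:
  assumes "initial C \<theta>" "A \<in> Obj C"
  obtains z where "z \<in> Hom C \<theta> A"
  using assms unfolding initial_def by blast

lemma initial_unique:
  assumes "initial C \<theta>" "f \<in> Hom C \<theta> A" "g \<in> Hom C \<theta> A"
  shows "f = g"
  using assms Hom_Obj(2) unfolding initial_def by blast

lemma binary_coproduct_iff:
  "binary_coproduct C A0 A1 Q n0 n1 \<longleftrightarrow>
     n0 \<in> Hom C A0 Q \<and> n1 \<in> Hom C A1 Q \<and>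
     (\<forall>X. \<forall>f0 \<in> Hom C A0 X. \<forall>f1 \<in> Hom C A1 X.
        \<exists>!h. h \<in> Hom C Q X \<and> h \<cdot> n0 = f0 \<and> h \<cdot> n1 = f1)" (is "?L \<longleftrightarrow> ?R")
proof
  assume L: ?L
  have n: "n0 \<in> Hom C A0 Q" "n1 \<in> Hom C A1 Q"
    using L unfolding binary_coproduct_def is_coproduct_def
    by (auto dest: spec[of _ True] spec[of _ False] simp: all_bool_eq)
  have "\<exists>!h. h \<in> Hom C Q X \<and> h \<cdot> n0 = f0 \<and> h \<cdot> n1 = f1"
    if "f0 \<in> Hom C A0 X" "f1 \<in> Hom C A1 X" for X f0 f1
  proof -
    have X: "X \<in> Obj C" using that Hom_Obj by blast
    have f: "\<forall>b \<in> UNIV. (if b then f1 else f0) \<in> Hom C (if b then A1 else A0) X"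
      using that by simp
    from L have "\<forall>Y \<in> Obj C. \<forall>f. (\<forall>b \<in> UNIV. f b \<in> Hom C (if b then A1 else A0) Y) \<longrightarrow>
        (\<exists>!h. h \<in> Hom C Q Y \<and> (\<forall>b \<in> UNIV. h \<cdot> (if b then n1 else n0) = f b))"
      unfolding binary_coproduct_def is_coproduct_def by blast
    from this[THEN bspec, OF X, THEN spec, THEN mp, OF f]
    have "\<exists>!h. h \<in> Hom C Q X \<and>
        (\<forall>b \<in> UNIV. h \<cdot> (if b then n1 else n0) = (if b then f1 else f0))" .
    then show ?thesis by (simp add: all_bool_eq conj_commute)
  qed
  with n show ?R by blast
next
  assume R: ?R
  show ?L
    unfolding binary_coproduct_def is_coproduct_def
  proof (intro conjI ballI allI impI)
    show "Q \<in> Obj C" using R Hom_Obj by blast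
    show "(if b then n1 else n0) \<in> Hom C (if b then A1 else A0) Q" for b
      using R by simp
    fix X f assume "\<forall>b \<in> UNIV. f b \<in> Hom C (if b then A1 else A0) X"
    then have "f False \<in> Hom C A0 X" "f True \<in> Hom C A1 X"
      by (auto simp: all_bool_eq)
    then have "\<exists>!h. h \<in> Hom C Q X \<and> h \<cdot> n0 = f False \<and> h \<cdot> n1 = f True"
      using R by blast
    then show "\<exists>!h. h \<in> Hom C Q X \<and> (\<forall>b \<in> UNIV. h \<cdot> (if b then n1 else n0) = f b)"
      by (simp add: all_bool_eq conj_commute)
  qed
qed

lemma binary_coproduct_Hom:
  assumes "binary_coproduct C A0 A1 Q n0 n1"
  shows "n0 \<in> Hom C A0 Q" "n1 \<in> Hom C A1 Q"
  using assms unfolding binary_coproduct_iff by blast+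

lemma binary_coproduct_ex1:
  assumes "binary_coproduct C A0 A1 Q n0 n1" "f0 \<in> Hom C A0 X" "f1 \<in> Hom C A1 X"
  shows "\<exists>!h. h \<in> Hom C Q X \<and> h \<cdot> n0 = f0 \<and> h \<cdot> n1 = f1"
  using assms unfolding binary_coproduct_iff by blast

lemma binary_coproduct_commute:
  "binary_coproduct C A0 A1 Q n0 n1 \<Longrightarrow> binary_coproduct C A1 A0 Q n1 n0"
  unfolding binary_coproduct_iff by (auto simp: conj_commute)

lemma is_coproduct_ex1:
  assumes "is_coproduct C I A Q \<nu>" "X \<in> Obj C" "\<And>i. i \<in> I \<Longrightarrow> f i \<in> Hom C (A i) X"
  shows "\<exists>!h. h \<in> Hom C Q X \<and> (\<forall>i \<in> I. h \<cdot> \<nu> i = f i)"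
  using assms unfolding is_coproduct_def by blast

lemma binary_coproduct_iso:
  assumes c: "binary_coproduct C A0 A1 Q n0 n1" and k: "k \<in> Hom C Q M" "invertible C k"
  shows "binary_coproduct C A0 A1 M (k \<cdot> n0) (k \<cdot> n1)"
  unfolding binary_coproduct_iff
proof (intro conjI allI ballI)
  note n = binary_coproduct_Hom[OF c]
  show "k \<cdot> n0 \<in> Hom C A0 M" "k \<cdot> n1 \<in> Hom C A1 M"
    using n k(1) by (blast intro: Comp_in_Hom)+
  obtain k' where k': "k' \<in> Hom C M Q" "k' \<cdot> k = Ident C Q" "k \<cdot> k' = Ident C M"
    using k by (blast elim: invertibleE)
  fix X f0 f1 assume f: "f0 \<in> Hom C A0 X" "f1 \<in> Hom C A1 X"
  then obtain h where h: "h \<in> Hom C Q X" "h \<cdot> n0 = f0" "h \<cdot> n1 = f1"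
    and h_unique: "\<And>h'. h' \<in> Hom C Q X \<Longrightarrow> h' \<cdot> n0 = f0 \<Longrightarrow> h' \<cdot> n1 = f1 \<Longrightarrow> h' = h"
    using binary_coproduct_ex1[OF c f] by blast
  have hk: "h \<cdot> k' \<in> Hom C M X" using h(1) k'(1) by (blast intro: Comp_in_Hom)
  have hkk: "(h \<cdot> k') \<cdot> k = h"
    using Comp_assoc[OF k(1) k'(1) h(1)] k'(2) Comp_Ident_right[OF h(1)] by simp
  show "\<exists>!g. g \<in> Hom C M X \<and> g \<cdot> k \<cdot> n0 = f0 \<and> g \<cdot> k \<cdot> n1 = f1"
  proof (rule ex1I[of _ "h \<cdot> k'"], intro conjI)
    show "h \<cdot> k' \<in> Hom C M X" by (fact hk)
    show "(h \<cdot> k') \<cdot> k \<cdot> n0 = f0" "(h \<cdot> k') \<cdot> k \<cdot> n1 = f1"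
      using Comp_assoc[OF n(1) k(1) hk] Comp_assoc[OF n(2) k(1) hk] hkk h(2,3) by simp_all
  next
    fix g assume g: "g \<in> Hom C M X \<and> g \<cdot> k \<cdot> n0 = f0 \<and> g \<cdot> k \<cdot> n1 = f1"
    then have gH: "g \<in> Hom C M X" by blast
    have "g \<cdot> k = h"
      using g Comp_assoc[OF n(1) k(1) gH] Comp_assoc[OF n(2) k(1) gH] Comp_in_Hom[OF k(1) gH]
      by (intro h_unique) auto
    then show "g = h \<cdot> k'"
      using Comp_assoc[OF k'(1) k(1) gH] k'(3) Comp_Ident_right[OF gH] by simp
  qed
qed

text \<open>
  Coproducts are associative: one summand of a family can be split off, the other summand of the
  resulting binary coproduct being a coproduct of the remaining family.
\<close>

lemma is_coproduct_split_off:
  assumes c: "is_coproduct C I A Q \<nu>" and i: "i \<in> I" and d: "is_coproduct C (I - {i}) A R \<mu>"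
  shows "\<exists>r. binary_coproduct C (A i) R Q (\<nu> i) r"
proof -
  have Q: "Q \<in> Obj C" and \<nu>: "\<And>j. j \<in> I \<Longrightarrow> \<nu> j \<in> Hom C (A j) Q"
    and \<mu>: "\<And>j. j \<in> I - {i} \<Longrightarrow> \<mu> j \<in> Hom C (A j) R"
    using c d unfolding is_coproduct_def by blast+
  have "\<exists>!r. r \<in> Hom C R Q \<and> (\<forall>j \<in> I - {i}. r \<cdot> \<mu> j = \<nu> j)"
    by (rule is_coproduct_ex1[OF d Q]) (use \<nu> in blast)
  then obtain r where r: "r \<in> Hom C R Q" "\<And>j. j \<in> I - {i} \<Longrightarrow> r \<cdot> \<mu> j = \<nu> j"
    by blast
  have "binary_coproduct C (A i) R Q (\<nu> i) r"
    unfolding binary_coproduct_iff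
  proof (intro conjI allI ballI)
    show "\<nu> i \<in> Hom C (A i) Q" "r \<in> Hom C R Q" using \<nu> i r by auto
    fix X f0 f1 assume f: "f0 \<in> Hom C (A i) X" "f1 \<in> Hom C R X"
    let ?f = "\<lambda>j. if j = i then f0 else f1 \<cdot> \<mu> j"
    have X: "X \<in> Obj C" using f Hom_Obj by blast
    have f1\<mu>: "f1 \<cdot> \<mu> j \<in> Hom C (A j) X" if "j \<in> I - {i}" for j
      using Comp_in_Hom[OF \<mu>[OF that] f(2)] .
    then have "?f j \<in> Hom C (A j) X" if "j \<in> I" for j
      using that f(1) by simp
    then obtain h where h: "h \<in> Hom C Q X" "\<And>j. j \<in> I \<Longrightarrow> h \<cdot> \<nu> j = ?f j"
      and h_unique: "\<And>h'. h' \<in> Hom C Q X \<Longrightarrow> (\<And>j. j \<in> I \<Longrightarrow> h' \<cdot> \<nu> j = ?f j) \<Longrightarrow> h' = h"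
      using is_coproduct_ex1[OF c X, of ?f] by blast
    have assoc: "(g \<cdot> r) \<cdot> \<mu> j = g \<cdot> \<nu> j" if "g \<in> Hom C Q X" "j \<in> I - {i}" for g j
      using Comp_assoc[OF \<mu>[OF that(2)] r(1) that(1)] r(2)[OF that(2)] by simp
    show "\<exists>!h. h \<in> Hom C Q X \<and> h \<cdot> \<nu> i = f0 \<and> h \<cdot> r = f1"
    proof (rule ex1I[of _ h], intro conjI)
      show "h \<in> Hom C Q X" by (fact h(1))
      show "h \<cdot> \<nu> i = f0" using h(2)[OF i] by simp
      have "h \<cdot> r \<in> Hom C R X" using r h(1) by (blast intro: Comp_in_Hom)
      moreover have "\<forall>j \<in> I - {i}. (h \<cdot> r) \<cdot> \<mu> j = f1 \<cdot> \<mu> j"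
        using assoc[OF h(1)] h(2) by simp
      ultimately show "h \<cdot> r = f1"
        using is_coproduct_ex1[OF d X, of "\<lambda>j. f1 \<cdot> \<mu> j"] f1\<mu> f(2) by blast
    next
      fix g assume g: "g \<in> Hom C Q X \<and> g \<cdot> \<nu> i = f0 \<and> g \<cdot> r = f1"
      then show "g = h" using assoc[of g] by (intro h_unique) auto
    qed
  qed
  then show ?thesis by blast
qed

lemma binary_coproduct_is_coproduct:
  assumes "binary_coproduct C A0 A1 Q n0 n1" "a \<noteq> b"
  shows "is_coproduct C {a, b} (\<lambda>i. if i = a then A0 else A1) Q (\<lambda>i. if i = a then n0 else n1)"
  unfolding is_coproduct_def
proof (intro conjI ballI allI impI)
  show "Q \<in> Obj C" using binary_coproduct_Hom[OF assms(1)] Hom_Obj by blast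
  show "(if i = a then n0 else n1) \<in> Hom C (if i = a then A0 else A1) Q" for i
    using binary_coproduct_Hom[OF assms(1)] by simp
  fix X f assume "\<forall>i \<in> {a, b}. f i \<in> Hom C (if i = a then A0 else A1) X"
  then have "f a \<in> Hom C A0 X" "f b \<in> Hom C A1 X" using assms(2) by auto
  from binary_coproduct_ex1[OF assms(1) this]
  show "\<exists>!h. h \<in> Hom C Q X \<and> (\<forall>i \<in> {a, b}. h \<cdot> (if i = a then n0 else n1) = f i)"
    using assms(2) by simp
qed

end


section \<open>Underlying functions\<close>

context concrete_category
begin

definition im :: "'m \<Rightarrow> 'u set" where
  "im f = ufun U f ` on_obj U (Dom C f)"

lemma im_Hom: "f \<in> Hom C A B \<Longrightarrow> im f = ufun U f ` on_obj U A"
  by (simp add: im_def source.Dom_Hom)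

lemma on_arr_eq:
  assumes "f \<in> Hom C A B"
  shows "on_arr U f = (on_obj U A, ufun U f, on_obj U B)"
    and "ufun U f \<in> on_obj U A \<rightarrow>\<^sub>E on_obj U B"
  using on_arr_in_Hom[OF assms] unfolding Hom_def set_cat_def ufun_def by auto

lemma ufun_in: "f \<in> Hom C A B \<Longrightarrow> x \<in> on_obj U A \<Longrightarrow> ufun U f x \<in> on_obj U B"
  using on_arr_eq(2) by blast

lemma ufun_Ident: "A \<in> Obj C \<Longrightarrow> x \<in> on_obj U A \<Longrightarrow> ufun U (Ident C A) x = x"
  by (simp add: ufun_def on_arr_Ident set_cat_def)

lemma ufun_Comp:
  assumes "f \<in> Hom C A B" "g \<in> Hom C B D" "x \<in> on_obj U A"
  shows "ufun U (g \<cdot>\<^bsub>C\<^esub> f) x = ufun U g (ufun U f x)"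
proof -
  have "on_arr U (g \<cdot>\<^bsub>C\<^esub> f) =
      (on_obj U A, compose (on_obj U A) (ufun U g) (ufun U f), on_obj U D)"
    unfolding on_arr_Comp[OF assms(1,2)] on_arr_eq(1)[OF assms(1)] on_arr_eq(1)[OF assms(2)]
    by (simp add: set_cat_def)
  then show ?thesis using assms(3) by (simp add: ufun_def[of U "g \<cdot>\<^bsub>C\<^esub> f"] compose_def)
qed

lemma ufun_eqI:
  assumes "f \<in> Hom C A B" "g \<in> Hom C A B" "\<And>x. x \<in> on_obj U A \<Longrightarrow> ufun U f x = ufun U g x"
  shows "f = g"
proof -
  have "ufun U f = ufun U g"
    using on_arr_eq(2)[OF assms(1)] on_arr_eq(2)[OF assms(2)] assms(3) by (intro PiE_ext)
  then show ?thesis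
    using assms(1,2) by (intro faithful) (auto simp: on_arr_eq(1))
qed

lemma im_subset: "f \<in> Hom C A B \<Longrightarrow> im f \<subseteq> on_obj U B"
  by (auto simp: im_Hom ufun_in)

lemma im_Comp:
  assumes "f \<in> Hom C A B" "g \<in> Hom C B D"
  shows "im (g \<cdot>\<^bsub>C\<^esub> f) = ufun U g ` im f"
  unfolding im_Hom[OF assms(1)] im_Hom[OF source.Comp_in_Hom[OF assms]] image_image
  using ufun_Comp[OF assms] by (intro image_cong) auto

lemma im_Comp_subset:
  assumes "f \<in> Hom C A B" "g \<in> Hom C B D"
  shows "im (g \<cdot>\<^bsub>C\<^esub> f) \<subseteq> im g"
  using im_Comp[OF assms] im_subset[OF assms(1)] by (auto simp: im_Hom[OF assms(2)])

lemma inj_monic: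
  assumes "f \<in> Hom C A B" "inj_on (ufun U f) (on_obj U A)"
  shows "monic C f"
  unfolding monic_def
proof (intro conjI allI ballI impI)
  show "f \<in> Arr C" using assms source.Arr_Hom by blast
  fix X g h
  assume g: "g \<in> Hom C X (Dom C f)" and h: "h \<in> Hom C X (Dom C f)" and eq: "f \<cdot>\<^bsub>C\<^esub> g = f \<cdot>\<^bsub>C\<^esub> h"
  from g h have gh: "g \<in> Hom C X A" "h \<in> Hom C X A"
    using source.Dom_Hom[OF assms(1)] by auto
  show "g = h"
  proof (rule ufun_eqI[OF gh])
    fix x assume x: "x \<in> on_obj U X"
    have "ufun U f (ufun U g x) = ufun U f (ufun U h x)"
      using eq ufun_Comp[OF gh(1) assms(1) x] ufun_Comp[OF gh(2) assms(1) x] by simp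
    then show "ufun U g x = ufun U h x"
      using assms(2) ufun_in[OF gh(1) x] ufun_in[OF gh(2) x] by (auto dest: inj_onD)
  qed
qed

lemma surj_epic:
  assumes "f \<in> Hom C A B" "im f = on_obj U B"
  shows "epic C f"
  unfolding epic_def
proof (intro conjI allI ballI impI)
  show "f \<in> Arr C" using assms source.Arr_Hom by blast
  fix X g h
  assume g: "g \<in> Hom C (Cod C f) X" and h: "h \<in> Hom C (Cod C f) X" and eq: "g \<cdot>\<^bsub>C\<^esub> f = h \<cdot>\<^bsub>C\<^esub> f"
  from g h have gh: "g \<in> Hom C B X" "h \<in> Hom C B X"
    using source.Cod_Hom[OF assms(1)] by auto
  show "g = h"
  proof (rule ufun_eqI[OF gh])
    fix y assume "y \<in> on_obj U B"
    then obtain x where "x \<in> on_obj U A" "y = ufun U f x"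
      using assms by (auto simp: im_Hom)
    then show "ufun U g y = ufun U h y"
      using eq ufun_Comp[OF assms(1) gh(1)] ufun_Comp[OF assms(1) gh(2)] by metis
  qed
qed

end


section \<open>Subobjects as subsets\<close>

context UD_category
begin

lemma factor_through_monic:
  assumes "f \<in> Hom C A B" "\<mu> \<in> Hom C T B" "monic C \<mu>" "im f \<subseteq> im \<mu>"
  obtains g where "g \<in> Hom C A T" "f = \<mu> \<cdot>\<^bsub>C\<^esub> g"
  using UD3[OF assms(1) source.subobjectI[OF assms(2,3)]] assms(4)
  by (auto simp: im_Hom[OF assms(1)] im_Hom[OF assms(2)])

lemma image_subobject:
  assumes "f \<in> Hom C A B"
  obtains S \<iota> where "\<iota> \<in> Hom C S B" "monic C \<iota>" "inj_on (ufun U \<iota>) (on_obj U S)" "im \<iota> = im f"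
proof -
  obtain S \<iota> where S: "subobject C B S \<iota>" "on_obj U S = ufun U f ` on_obj U A"
    "ufun U \<iota> = (\<lambda>x\<in>on_obj U S. x)"
    using UD2[OF assms] by blast
  then have \<iota>: "\<iota> \<in> Hom C S B" "monic C \<iota>" by (auto simp: subobject_def)
  have "im \<iota> = on_obj U S" "inj_on (ufun U \<iota>) (on_obj U S)"
    using S(3) by (auto simp: im_Hom[OF \<iota>(1)] inj_on_def)
  then show ?thesis using that[OF \<iota>] S(2) im_Hom[OF assms] by simp
qed

text \<open>
  A monomorphism and the inclusion of its image factor through each other by \<open>UD3\<close>, so the first
  is the second preceded by an isomorphism; hence it is injective.
\<close>

lemma monic_iff_inj:
  assumes f: "f \<in> Hom C A B"
  shows "monic C f \<longleftrightarrow> inj_on (ufun U f) (on_obj U A)"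
proof
  assume m: "monic C f"
  obtain S \<iota> where \<iota>: "\<iota> \<in> Hom C S B" "monic C \<iota>" "inj_on (ufun U \<iota>) (on_obj U S)" "im \<iota> = im f"
    by (rule image_subobject[OF f])
  obtain g where g: "g \<in> Hom C A S" "f = \<iota> \<cdot>\<^bsub>C\<^esub> g"
    using factor_through_monic[OF f \<iota>(1,2)] \<iota>(4) by auto
  obtain h where h: "h \<in> Hom C S A" "\<iota> = f \<cdot>\<^bsub>C\<^esub> h"
    using factor_through_monic[OF \<iota>(1) f m] \<iota>(4) by auto
  have A: "A \<in> Obj C" using f source.Hom_Obj by blast
  have "f \<cdot>\<^bsub>C\<^esub> (h \<cdot>\<^bsub>C\<^esub> g) = f \<cdot>\<^bsub>C\<^esub> Ident C A"
    using source.Comp_Ident_right[OF f]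
    by (simp flip: source.Comp_assoc[OF g(1) h(1) f] h(2) g(2))
  then have hg: "h \<cdot>\<^bsub>C\<^esub> g = Ident C A"
    using source.monicD[OF m f] source.Comp_in_Hom[OF g(1) h(1)] source.Ident_in_Hom[OF A] by blast
  show "inj_on (ufun U f) (on_obj U A)"
  proof (rule inj_onI)
    fix x y assume xy: "x \<in> on_obj U A" "y \<in> on_obj U A" "ufun U f x = ufun U f y"
    then have "ufun U \<iota> (ufun U g x) = ufun U \<iota> (ufun U g y)"
      using ufun_Comp[OF g(1) \<iota>(1)] g(2) by simp
    then have "ufun U g x = ufun U g y"
      using \<iota>(3) ufun_in[OF g(1)] xy by (auto dest: inj_onD)
    then have "ufun U (h \<cdot>\<^bsub>C\<^esub> g) x = ufun U (h \<cdot>\<^bsub>C\<^esub> g) y"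
      using ufun_Comp[OF g(1) h(1)] xy by simp
    then show "x = y" using hg ufun_Ident[OF A] xy by simp
  qed
qed (rule inj_monic[OF f])

lemma monic_ufun_eqD:
  assumes "monic C f" "f \<in> Hom C A B" "x \<in> on_obj U A" "y \<in> on_obj U A" "ufun U f x = ufun U f y"
  shows "x = y"
  using assms monic_iff_inj[OF assms(2)] by (auto dest: inj_onD)

lemma monic_im_iff:
  assumes "monic C f" "f \<in> Hom C A B" "g \<in> Hom C X A" "x \<in> on_obj U A"
  shows "ufun U f x \<in> im (f \<cdot>\<^bsub>C\<^esub> g) \<longleftrightarrow> x \<in> im g"
  using monic_ufun_eqD[OF assms(1,2,4)] im_subset[OF assms(3)]
  unfolding im_Comp[OF assms(3,2)] by blast

lemma monic_Comp:
  assumes "monic C f" "f \<in> Hom C A B" "monic C g" "g \<in> Hom C B D"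
  shows "monic C (g \<cdot>\<^bsub>C\<^esub> f)"
proof (rule inj_monic[OF source.Comp_in_Hom[OF assms(2,4)]], rule inj_onI)
  fix x y
  assume xy: "x \<in> on_obj U A" "y \<in> on_obj U A" "ufun U (g \<cdot>\<^bsub>C\<^esub> f) x = ufun U (g \<cdot>\<^bsub>C\<^esub> f) y"
  then show "x = y"
    using assms monic_ufun_eqD ufun_Comp[OF assms(2,4)] ufun_in[OF assms(2)] by metis
qed

lemma monic_right_factor:
  assumes "monic C (g \<cdot>\<^bsub>C\<^esub> f)" "f \<in> Hom C A B" "g \<in> Hom C B D"
  shows "monic C f"
proof (rule inj_monic[OF assms(2)], rule inj_onI)
  fix x y
  assume xy: "x \<in> on_obj U A" "y \<in> on_obj U A" "ufun U f x = ufun U f y"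
  then show "x = y"
    using monic_ufun_eqD[OF assms(1) source.Comp_in_Hom[OF assms(2,3)]] ufun_Comp[OF assms(2,3)]
    by metis
qed

text \<open>
  An injective morphism is monic and a surjective one is epic by faithfulness, so balancedness
  applies.
\<close>

lemma bij_invertible:
  assumes "f \<in> Hom C A B" "inj_on (ufun U f) (on_obj U A)" "im f = on_obj U B"
  shows "invertible C f"
  using inj_monic[OF assms(1,2)] surj_epic[OF assms(1,3)] UD1_balanced
  unfolding balanced_def by blast

text \<open>
  The axioms about small families apply to pairs through a two-element small index set.
\<close>

lemma small_pair:
  obtains a b :: 'u where "a \<noteq> b" "{a, b} \<in> \<S>"
proof -
  obtain X where X: "X \<in> \<S>" "infinite X" using small_infinite by blast
  then obtain a where a: "a \<in> X" using infinite_imp_nonempty by blast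
  have "infinite (X - {a})" using X(2) by simp
  then obtain b where "b \<in> X - {a}" using infinite_imp_nonempty by blast
  then show ?thesis using that[of a b] small_subset[OF X(1), of "{a, b}"] a by blast
qed

lemma
  assumes f: "f \<in> Hom C A M" "monic C f" and g: "g \<in> Hom C B M" "monic C g"
  shows intersection_subobject: "\<exists>P \<iota>. \<iota> \<in> Hom C P M \<and> monic C \<iota> \<and> im \<iota> = im f \<inter> im g \<and>
      is_intersection C U M (UNIV :: bool set)
        (\<lambda>b. if b then B else A) (\<lambda>b. if b then g else f) P \<iota>" (is ?meet)
    and union_subobject: "\<exists>P \<iota>. \<iota> \<in> Hom C P M \<and> monic C \<iota> \<and> im \<iota> = im f \<union> im g" (is ?join)
proof -
  obtain a b :: 'u where ab: "a \<noteq> b" "{a, b} \<in> \<S>" by (rule small_pair)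
  let ?S = "\<lambda>i. if i = a then A else B" and ?\<nu> = "\<lambda>i. if i = a then f else g"
  have "subobject C M (?S i) (?\<nu> i)" for i
    using f g by (simp add: source.subobjectI)
  then have ex: "\<exists>P \<iota>. is_intersection C U M {a, b} ?S ?\<nu> P \<iota>"
    "\<exists>P \<iota>. is_union C U M {a, b} ?S ?\<nu> P \<iota>"
    using UD4[of M "{a, b}" ?S ?\<nu>] ab(2) source.Hom_Obj(2)[OF f(1)] by auto
  have incl: "im \<iota> = on_obj U P" if "\<iota> \<in> Hom C P M" "ufun U \<iota> = (\<lambda>x\<in>on_obj U P. x)" for P \<iota>
    using that by (auto simp: im_Hom)
  from ex(1) obtain P \<iota> where "is_intersection C U M {a, b} ?S ?\<nu> P \<iota>" by blast
  then have "\<iota> \<in> Hom C P M \<and> monic C \<iota> \<and> im \<iota> = im f \<inter> im g \<and>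
      is_intersection C U M (UNIV :: bool set)
        (\<lambda>b. if b then B else A) (\<lambda>b. if b then g else f) P \<iota>"
    using ab(1) incl[of \<iota> P] im_subset[of \<iota> P M]
    by (simp add: is_intersection_def subobject_def im_Hom[OF f(1)] im_Hom[OF g(1)] UNIV_bool
        Int_commute)
  then show ?meet by blast
  from ex(2) obtain P \<iota> where "is_union C U M {a, b} ?S ?\<nu> P \<iota>" by blast
  then have "\<iota> \<in> Hom C P M \<and> monic C \<iota> \<and> im \<iota> = im f \<union> im g"
    using ab(1) incl[of \<iota> P]
    by (simp add: is_union_def subobject_def im_Hom[OF f(1)] im_Hom[OF g(1)])
  then show ?join by blast
qed

text \<open>
  The intersection of the images is itself a subobject of \<open>M\<close> that factors through \<open>\<gamma>\<close> and
  \<open>\<delta>\<close>, so a pull-back has to receive a morphism from it. Conversely, \<open>UD3\<close> lifts every cone whose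
  image lies in the image of \<open>\<gamma> \<cdot> \<alpha>\<close>.
\<close>

lemma pullback_iff_im:
  assumes \<alpha>: "\<alpha> \<in> Hom C P A" "monic C \<alpha>" and \<beta>: "\<beta> \<in> Hom C P B"
    and \<gamma>: "\<gamma> \<in> Hom C A M" "monic C \<gamma>" and \<delta>: "\<delta> \<in> Hom C B M" "monic C \<delta>"
    and comm: "\<gamma> \<cdot>\<^bsub>C\<^esub> \<alpha> = \<delta> \<cdot>\<^bsub>C\<^esub> \<beta>"
  shows "is_pullback C P A B M \<alpha> \<beta> \<gamma> \<delta> \<longleftrightarrow> im \<gamma> \<inter> im \<delta> \<subseteq> im (\<gamma> \<cdot>\<^bsub>C\<^esub> \<alpha>)"
proof
  assume pb: "is_pullback C P A B M \<alpha> \<beta> \<gamma> \<delta>"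
  obtain W \<iota> where \<iota>: "\<iota> \<in> Hom C W M" "im \<iota> = im \<gamma> \<inter> im \<delta>"
    using intersection_subobject[OF \<gamma> \<delta>] by blast
  obtain f where f: "f \<in> Hom C W A" "\<iota> = \<gamma> \<cdot>\<^bsub>C\<^esub> f"
    using factor_through_monic[OF \<iota>(1) \<gamma>] \<iota>(2) by auto
  obtain g where g: "g \<in> Hom C W B" "\<iota> = \<delta> \<cdot>\<^bsub>C\<^esub> g"
    using factor_through_monic[OF \<iota>(1) \<delta>] \<iota>(2) by auto
  obtain h where h: "h \<in> Hom C W P" "\<alpha> \<cdot>\<^bsub>C\<^esub> h = f"
    using pb f g unfolding is_pullback_def by metis
  have "\<iota> = (\<gamma> \<cdot>\<^bsub>C\<^esub> \<alpha>) \<cdot>\<^bsub>C\<^esub> h" using source.Comp_assoc[OF h(1) \<alpha>(1) \<gamma>(1)] h(2) f(2) by simp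
  then show "im \<gamma> \<inter> im \<delta> \<subseteq> im (\<gamma> \<cdot>\<^bsub>C\<^esub> \<alpha>)"
    using im_Comp_subset[OF h(1) source.Comp_in_Hom[OF \<alpha>(1) \<gamma>(1)]] \<iota>(2) by simp
next
  assume sub: "im \<gamma> \<inter> im \<delta> \<subseteq> im (\<gamma> \<cdot>\<^bsub>C\<^esub> \<alpha>)"
  have "\<exists>!h. h \<in> Hom C X P \<and> \<alpha> \<cdot>\<^bsub>C\<^esub> h = f \<and> \<beta> \<cdot>\<^bsub>C\<^esub> h = g"
    if f: "f \<in> Hom C X A" and g: "g \<in> Hom C X B" and eq: "\<gamma> \<cdot>\<^bsub>C\<^esub> f = \<delta> \<cdot>\<^bsub>C\<^esub> g" for X f g
  proof -
    have "im (\<gamma> \<cdot>\<^bsub>C\<^esub> f) \<subseteq> im (\<gamma> \<cdot>\<^bsub>C\<^esub> \<alpha>)"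
      using sub im_Comp_subset[OF f \<gamma>(1)] im_Comp_subset[OF g \<delta>(1)] eq by auto
    then obtain h where h: "h \<in> Hom C X P" "\<gamma> \<cdot>\<^bsub>C\<^esub> f = (\<gamma> \<cdot>\<^bsub>C\<^esub> \<alpha>) \<cdot>\<^bsub>C\<^esub> h"
      using factor_through_monic source.Comp_in_Hom[OF f \<gamma>(1)] source.Comp_in_Hom[OF \<alpha>(1) \<gamma>(1)]
        monic_Comp[OF \<alpha>(2,1) \<gamma>(2,1)] by blast
    have "\<gamma> \<cdot>\<^bsub>C\<^esub> f = \<gamma> \<cdot>\<^bsub>C\<^esub> (\<alpha> \<cdot>\<^bsub>C\<^esub> h)"
      using h source.Comp_assoc[OF h(1) \<alpha>(1) \<gamma>(1)] by simp
    then have f_eq: "f = \<alpha> \<cdot>\<^bsub>C\<^esub> h"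
      using source.monicD[OF \<gamma>(2,1) f] source.Comp_in_Hom[OF h(1) \<alpha>(1)] by blast
    have "\<delta> \<cdot>\<^bsub>C\<^esub> g = \<delta> \<cdot>\<^bsub>C\<^esub> (\<beta> \<cdot>\<^bsub>C\<^esub> h)"
      using h(2) eq comm source.Comp_assoc[OF h(1) \<beta> \<delta>(1)] by simp
    then have g_eq: "g = \<beta> \<cdot>\<^bsub>C\<^esub> h"
      using source.monicD[OF \<delta>(2,1) g] source.Comp_in_Hom[OF h(1) \<beta>] by blast
    show ?thesis
      using h(1) f_eq g_eq source.monicD[OF \<alpha>(2,1)] by metis
  qed
  then show "is_pullback C P A B M \<alpha> \<beta> \<gamma> \<delta>"
    unfolding is_pullback_def using \<alpha> \<beta> \<gamma> \<delta> comm by blast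
qed


section \<open>Coproducts as covers\<close>

lemma im_initial_subset:
  assumes "initial C \<theta>" "z \<in> Hom C \<theta> M" "f \<in> Hom C A M"
  shows "im z \<subseteq> im f"
proof -
  obtain w where w: "w \<in> Hom C \<theta> A"
    using source.initial_Hom[OF assms(1) source.Hom_Obj(1)[OF assms(3)]] .
  then have "z = f \<cdot>\<^bsub>C\<^esub> w"
    using source.initial_unique[OF assms(1,2)] source.Comp_in_Hom[OF w assms(3)] by blast
  then show ?thesis using im_Comp_subset[OF w assms(3)] by simp
qed

text \<open>
  The union of the two images is a subobject \<open>\<iota>\<close>. Both injections factor through \<open>\<iota>\<close>, so the
  universal property yields a section of \<open>\<iota>\<close>.
\<close>

lemma binary_coproduct_cover:
  assumes c: "binary_coproduct C A0 A1 Q n0 n1"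
  shows "im n0 \<union> im n1 = on_obj U Q"
proof
  note n = source.binary_coproduct_Hom[OF c]
  show "im n0 \<union> im n1 \<subseteq> on_obj U Q" using im_subset n by blast
  obtain W \<iota> where \<iota>: "\<iota> \<in> Hom C W Q" "monic C \<iota>" "im \<iota> = im n0 \<union> im n1"
    using union_subobject n UD5_monic[OF c] by blast
  obtain g0 where g0: "g0 \<in> Hom C A0 W" "n0 = \<iota> \<cdot>\<^bsub>C\<^esub> g0"
    using factor_through_monic[OF n(1) \<iota>(1,2)] \<iota>(3) by auto
  obtain g1 where g1: "g1 \<in> Hom C A1 W" "n1 = \<iota> \<cdot>\<^bsub>C\<^esub> g1"
    using factor_through_monic[OF n(2) \<iota>(1,2)] \<iota>(3) by auto
  obtain h where h: "h \<in> Hom C Q W" "h \<cdot>\<^bsub>C\<^esub> n0 = g0" "h \<cdot>\<^bsub>C\<^esub> n1 = g1"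
    using source.binary_coproduct_ex1[OF c g0(1) g1(1)] by blast
  have Q: "Q \<in> Obj C" using n source.Hom_Obj by blast
  have "(\<iota> \<cdot>\<^bsub>C\<^esub> h) \<cdot>\<^bsub>C\<^esub> n0 = n0" "(\<iota> \<cdot>\<^bsub>C\<^esub> h) \<cdot>\<^bsub>C\<^esub> n1 = n1"
    using source.Comp_assoc[OF n(1) h(1) \<iota>(1)] source.Comp_assoc[OF n(2) h(1) \<iota>(1)] h g0 g1
    by simp_all
  moreover have "Ident C Q \<cdot>\<^bsub>C\<^esub> n0 = n0" "Ident C Q \<cdot>\<^bsub>C\<^esub> n1 = n1"
    using n source.Comp_Ident_left by blast+
  ultimately have "\<iota> \<cdot>\<^bsub>C\<^esub> h = Ident C Q"
    using source.binary_coproduct_ex1[OF c n] source.Comp_in_Hom[OF h(1) \<iota>(1)]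
      source.Ident_in_Hom[OF Q] by blast
  then have "im (Ident C Q) \<subseteq> im \<iota>" using im_Comp_subset[OF h(1) \<iota>(1)] by simp
  moreover have "im (Ident C Q) = on_obj U Q"
    using ufun_Ident[OF Q] by (simp add: im_Hom[OF source.Ident_in_Hom[OF Q]])
  ultimately show "on_obj U Q \<subseteq> im n0 \<union> im n1" using \<iota>(3) by simp
qed

text \<open>
  \<open>UD5\<close> only says that the intersection is isomorphic to an initial object; that it is the image
  of the initial morphism \<open>z\<close> follows by uniqueness of morphisms out of \<open>\<theta>\<close>.
\<close>

lemma binary_coproduct_meet:
  assumes c: "binary_coproduct C A0 A1 Q n0 n1" and \<theta>: "initial C \<theta>" and z: "z \<in> Hom C \<theta> Q"
  shows "im n0 \<inter> im n1 = im z"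
proof
  note n = source.binary_coproduct_Hom[OF c]
  show "im z \<subseteq> im n0 \<inter> im n1" using im_initial_subset[OF \<theta> z] n by blast
  obtain P \<iota> where P: "\<iota> \<in> Hom C P Q" "im \<iota> = im n0 \<inter> im n1"
    "is_intersection C U Q (UNIV :: bool set)
      (\<lambda>b. if b then A1 else A0) (\<lambda>b. if b then n1 else n0) P \<iota>"
    using intersection_subobject[of n0 A0 Q n1 A1] n UD5_monic[OF c] by blast
  obtain k where k: "k \<in> Hom C P \<theta>" "invertible C k"
    using UD5_disjoint[OF c \<theta> P(3)] unfolding isomorphic_def by blast
  obtain k' where k': "k' \<in> Hom C \<theta> P" "k' \<cdot>\<^bsub>C\<^esub> k = Ident C P"
    using source.invertibleE[OF k(2,1)] by blast
  have "\<iota> \<cdot>\<^bsub>C\<^esub> k' = z"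
    using source.initial_unique[OF \<theta> _ z] source.Comp_in_Hom[OF k'(1) P(1)] by blast
  then have "\<iota> = z \<cdot>\<^bsub>C\<^esub> k"
    using source.Comp_assoc[OF k(1) k'(1) P(1)] k'(2) source.Comp_Ident_right[OF P(1)] by simp
  then show "im n0 \<inter> im n1 \<subseteq> im z" using im_Comp_subset[OF k(1) z] P(2) by simp
qed

lemma is_coproduct_exists:
  assumes "I \<in> \<S>" "\<And>i. i \<in> I \<Longrightarrow> A i \<in> Obj C"
  obtains Q \<nu> where "is_coproduct C I A Q \<nu>"
  using assms UD1_coproducts unfolding coproduct_complete_def by blast

lemma binary_coproduct_exists:
  assumes "A0 \<in> Obj C" "A1 \<in> Obj C"
  shows "\<exists>Q n0 n1. binary_coproduct C A0 A1 Q n0 n1"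
proof -
  obtain a b :: 'u where ab: "a \<noteq> b" "{a, b} \<in> \<S>" by (rule small_pair)
  let ?A = "\<lambda>i. if i = a then A0 else A1"
  obtain Q \<nu> where c: "is_coproduct C {a, b} ?A Q \<nu>"
    by (rule is_coproduct_exists[OF ab(2), of ?A]) (use assms in simp)
  have n: "\<nu> a \<in> Hom C A0 Q" "\<nu> b \<in> Hom C A1 Q"
    using c ab(1) unfolding is_coproduct_def by auto
  have "binary_coproduct C A0 A1 Q (\<nu> a) (\<nu> b)"
    unfolding source.binary_coproduct_iff
  proof (intro conjI n allI ballI)
    fix X f0 f1 assume f: "f0 \<in> Hom C A0 X" "f1 \<in> Hom C A1 X"
    then have "X \<in> Obj C" using source.Hom_Obj by blast
    then show "\<exists>!h. h \<in> Hom C Q X \<and> h \<cdot>\<^bsub>C\<^esub> \<nu> a = f0 \<and> h \<cdot>\<^bsub>C\<^esub> \<nu> b = f1"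
      using source.is_coproduct_ex1[OF c, of X "\<lambda>i. if i = a then f0 else f1"] f ab(1) by auto
  qed
  then show ?thesis by blast
qed

text \<open>
  For the converse direction the candidate is compared with an actual coproduct. A point \<open>z t\<close>
  shared by the two images comes from the initial object, and monomorphisms reflect
  it: its preimages in both summands are the images of the same \<open>t\<close>.
\<close>

lemma binary_coproduct_iff_im:
  assumes f: "f0 \<in> Hom C A0 M" "f1 \<in> Hom C A1 M" and \<theta>: "initial C \<theta>" and z: "z \<in> Hom C \<theta> M"
  shows "binary_coproduct C A0 A1 M f0 f1 \<longleftrightarrow>
    monic C f0 \<and> monic C f1 \<and> im f0 \<union> im f1 = on_obj U M \<and> im f0 \<inter> im f1 \<subseteq> im z"
    (is "?L \<longleftrightarrow> ?R")
proof
  show ?R if ?L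
    using UD5_monic[OF that] binary_coproduct_cover[OF that] binary_coproduct_meet[OF that \<theta> z]
    by blast
next
  assume R: ?R
  obtain Q n0 n1 where c: "binary_coproduct C A0 A1 Q n0 n1"
    using binary_coproduct_exists f source.Hom_Obj by blast
  note n = source.binary_coproduct_Hom[OF c]
  obtain k where k: "k \<in> Hom C Q M" "k \<cdot>\<^bsub>C\<^esub> n0 = f0" "k \<cdot>\<^bsub>C\<^esub> n1 = f1"
    using source.binary_coproduct_ex1[OF c f] by blast
  have kn: "ufun U k (ufun U n0 a) = ufun U f0 a" if "a \<in> on_obj U A0" for a
    using ufun_Comp[OF n(1) k(1) that] k(2) by simp
  have kn': "ufun U k (ufun U n1 a) = ufun U f1 a" if "a \<in> on_obj U A1" for a
    using ufun_Comp[OF n(2) k(1) that] k(3) by simp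
  obtain w0 where w0: "w0 \<in> Hom C \<theta> A0"
    using source.initial_Hom[OF \<theta> source.Hom_Obj(1)[OF f(1)]] .
  obtain w1 where w1: "w1 \<in> Hom C \<theta> A1"
    using source.initial_Hom[OF \<theta> source.Hom_Obj(1)[OF f(2)]] .
  have zf: "f0 \<cdot>\<^bsub>C\<^esub> w0 = z" "f1 \<cdot>\<^bsub>C\<^esub> w1 = z" and nw: "n0 \<cdot>\<^bsub>C\<^esub> w0 = n1 \<cdot>\<^bsub>C\<^esub> w1"
    using source.initial_unique[OF \<theta>] z w0 w1 f n source.Comp_in_Hom by blast+
  have mixed: "ufun U n0 a = ufun U n1 b"
    if a: "a \<in> on_obj U A0" and b: "b \<in> on_obj U A1" and eq: "ufun U f0 a = ufun U f1 b" for a b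
  proof -
    have "ufun U f0 a \<in> im f0 \<inter> im f1"
      using imageI[OF a, of "ufun U f0"] imageI[OF b, of "ufun U f1"] eq
      by (simp add: im_Hom[OF f(1)] im_Hom[OF f(2)])
    then obtain t where t: "t \<in> on_obj U \<theta>" "ufun U f0 a = ufun U z t"
      using R by (auto simp: im_Hom[OF z])
    have "ufun U f0 a = ufun U f0 (ufun U w0 t)"
      using t(2) zf(1) ufun_Comp[OF w0 f(1) t(1)] by simp
    then have a_eq: "a = ufun U w0 t"
      using monic_ufun_eqD[OF _ f(1) a ufun_in[OF w0 t(1)]] R by blast
    have "ufun U f1 b = ufun U f1 (ufun U w1 t)"
      using t(2) zf(2) ufun_Comp[OF w1 f(2) t(1)] eq by simp
    then have b_eq: "b = ufun U w1 t"
      using monic_ufun_eqD[OF _ f(2) b ufun_in[OF w1 t(1)]] R by blast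
    show ?thesis
      using a_eq b_eq nw ufun_Comp[OF w0 n(1) t(1)] ufun_Comp[OF w1 n(2) t(1)] by simp
  qed
  have "inj_on (ufun U k) (on_obj U Q)"
  proof (rule inj_onI)
    fix x y assume xy: "x \<in> on_obj U Q" "y \<in> on_obj U Q" and eq: "ufun U k x = ufun U k y"
    have cov: "(\<exists>a \<in> on_obj U A0. x = ufun U n0 a) \<or> (\<exists>b \<in> on_obj U A1. x = ufun U n1 b)"
      if "x \<in> on_obj U Q" for x
      using binary_coproduct_cover[OF c] that by (auto simp: im_Hom[OF n(1)] im_Hom[OF n(2)])
    from cov[OF xy(1)] cov[OF xy(2)] show "x = y"
    proof (elim disjE bexE)
      fix a b assume "a \<in> on_obj U A0" "x = ufun U n0 a" "b \<in> on_obj U A0" "y = ufun U n0 b"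
      then show ?thesis using eq kn R monic_ufun_eqD[OF _ f(1)] by metis
    next
      fix a b assume "a \<in> on_obj U A0" "x = ufun U n0 a" "b \<in> on_obj U A1" "y = ufun U n1 b"
      then show ?thesis using eq kn kn' mixed by metis
    next
      fix a b assume "a \<in> on_obj U A1" "x = ufun U n1 a" "b \<in> on_obj U A0" "y = ufun U n0 b"
      then show ?thesis using eq kn kn' mixed by metis
    next
      fix a b assume "a \<in> on_obj U A1" "x = ufun U n1 a" "b \<in> on_obj U A1" "y = ufun U n1 b"
      then show ?thesis using eq kn' R monic_ufun_eqD[OF _ f(2)] by metis
    qed
  qed
  moreover have "im k = on_obj U M"
    using R im_Comp_subset[OF n(1) k(1)] im_Comp_subset[OF n(2) k(1)] k(2,3) im_subset[OF k(1)]
    by auto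
  ultimately have "invertible C k" using bij_invertible[OF k(1)] by blast
  then show ?L using source.binary_coproduct_iso[OF c k(1)] k(2,3) by simp
qed

text \<open>
  Two summands suffice: the other summands of a family can be collected into one, since
  families over smaller index sets have coproducts as well.
\<close>

lemma coproduct_injections_iff:
  "\<gamma> \<in> coproduct_injections \<S> C \<longleftrightarrow> (\<exists>A A' M \<gamma>'. binary_coproduct C A A' M \<gamma> \<gamma>')"
proof
  assume "\<gamma> \<in> coproduct_injections \<S> C"
  then obtain I A Q \<nu> i where I: "I \<in> \<S>" and c: "is_coproduct C I A Q \<nu>"
    and i: "i \<in> I" and \<gamma>: "\<gamma> = \<nu> i"
    unfolding coproduct_injections_def by blast
  have "\<And>j. j \<in> I \<Longrightarrow> A j \<in> Obj C"
    using c source.Hom_Obj unfolding is_coproduct_def by blast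
  then obtain R \<mu> where "is_coproduct C (I - {i}) A R \<mu>"
    using is_coproduct_exists[OF small_subset[OF I, of "I - {i}"], of A] by blast
  then show "\<exists>A A' M \<gamma>'. binary_coproduct C A A' M \<gamma> \<gamma>'"
    using source.is_coproduct_split_off[OF c i] \<gamma> by blast
next
  assume "\<exists>A A' M \<gamma>'. binary_coproduct C A A' M \<gamma> \<gamma>'"
  then obtain A A' M \<gamma>' where c: "binary_coproduct C A A' M \<gamma> \<gamma>'" by blast
  obtain a b :: 'u where ab: "a \<noteq> b" "{a, b} \<in> \<S>" by (rule small_pair)
  let ?\<nu> = "\<lambda>i. if i = a then \<gamma> else \<gamma>'"
  have "is_coproduct C {a, b} (\<lambda>i. if i = a then A else A') M ?\<nu>"
    using source.binary_coproduct_is_coproduct[OF c ab(1)] .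
  moreover have "\<gamma> = ?\<nu> a" by simp
  ultimately show "\<gamma> \<in> coproduct_injections \<S> C"
    using ab(2) unfolding coproduct_injections_def by blast
qed

lemma coproduct_injection_complement:
  assumes "\<gamma> \<in> Hom C A M" "\<gamma> \<in> coproduct_injections \<S> C"
  obtains A' \<gamma>' where "binary_coproduct C A A' M \<gamma> \<gamma>'"
  using assms source.binary_coproduct_Hom source.Dom_Hom source.Cod_Hom
  unfolding coproduct_injections_iff by metis

lemma coproduct_injection_monic: "\<gamma> \<in> coproduct_injections \<S> C \<Longrightarrow> monic C \<gamma>"
  using UD5_monic unfolding coproduct_injections_iff by blast


section \<open>Mono-extensivity\<close>

text \<open>
  By distributivity, a coproduct \<open>M = B \<squnion> B'\<close> restricts to \<open>A = (A \<inter> B) \<squnion> (A \<inter> B')\<close>; injectivity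
  of \<open>\<gamma>\<close> transfers covering and meeting from subsets of \<open>M\<close> to subsets of \<open>A\<close>.
\<close>

lemma subobject_restrict_coproduct:
  assumes \<gamma>: "\<gamma> \<in> Hom C A M" "monic C \<gamma>" and c: "binary_coproduct C B B' M \<delta> \<delta>'"
    and \<alpha>: "\<alpha> \<in> Hom C P A" "im (\<gamma> \<cdot>\<^bsub>C\<^esub> \<alpha>) = im \<gamma> \<inter> im \<delta>" "monic C \<alpha>"
    and \<alpha>': "\<alpha>' \<in> Hom C P' A" "im (\<gamma> \<cdot>\<^bsub>C\<^esub> \<alpha>') = im \<gamma> \<inter> im \<delta>'" "monic C \<alpha>'"
  shows "binary_coproduct C P P' A \<alpha> \<alpha>'"
proof -
  obtain \<theta> where \<theta>: "initial C \<theta>" using UD1_initial by blast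
  obtain z where z: "z \<in> Hom C \<theta> A"
    using source.initial_Hom[OF \<theta> source.Hom_Obj(1)[OF \<gamma>(1)]] .
  have meet: "im \<delta> \<inter> im \<delta>' = im (\<gamma> \<cdot>\<^bsub>C\<^esub> z)"
    using binary_coproduct_meet[OF c \<theta> source.Comp_in_Hom[OF z \<gamma>(1)]] .
  have pt: "ufun U \<gamma> a \<in> im \<gamma>" "ufun U \<gamma> a \<in> im \<delta> \<union> im \<delta>'" if "a \<in> on_obj U A" for a
    using that ufun_in[OF \<gamma>(1)] binary_coproduct_cover[OF c] by (auto simp: im_Hom[OF \<gamma>(1)])
  have "on_obj U A \<subseteq> im \<alpha> \<union> im \<alpha>'"
    using pt \<alpha>(2) \<alpha>'(2) monic_im_iff[OF \<gamma>(2,1) \<alpha>(1)] monic_im_iff[OF \<gamma>(2,1) \<alpha>'(1)] by blast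
  moreover have "im \<alpha> \<union> im \<alpha>' \<subseteq> on_obj U A"
    using im_subset \<alpha>(1) \<alpha>'(1) by blast
  moreover have "im \<alpha> \<inter> im \<alpha>' \<subseteq> im z"
  proof
    fix a assume a: "a \<in> im \<alpha> \<inter> im \<alpha>'"
    then have aA: "a \<in> on_obj U A" using im_subset[OF \<alpha>(1)] by blast
    then have "ufun U \<gamma> a \<in> im \<delta> \<inter> im \<delta>'"
      using a \<alpha>(2) \<alpha>'(2) monic_im_iff[OF \<gamma>(2,1) \<alpha>(1)] monic_im_iff[OF \<gamma>(2,1) \<alpha>'(1)] by blast
    then show "a \<in> im z" using meet monic_im_iff[OF \<gamma>(2,1) z aA] by blast
  qed
  ultimately show ?thesis
    using binary_coproduct_iff_im[OF \<alpha>(1) \<alpha>'(1) \<theta> z] \<alpha>(3) \<alpha>'(3) by blast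
qed

lemma subobject_intersection_factor:
  assumes \<gamma>: "\<gamma> \<in> Hom C A M" "monic C \<gamma>" and \<delta>: "\<delta> \<in> Hom C B M" "monic C \<delta>"
  obtains P \<alpha> \<beta> where "\<alpha> \<in> Hom C P A" "monic C \<alpha>" "\<beta> \<in> Hom C P B" "monic C \<beta>" "\<gamma> \<cdot>\<^bsub>C\<^esub> \<alpha> = \<delta> \<cdot>\<^bsub>C\<^esub> \<beta>"
    "im (\<gamma> \<cdot>\<^bsub>C\<^esub> \<alpha>) = im \<gamma> \<inter> im \<delta>"
proof -
  obtain P \<iota> where \<iota>: "\<iota> \<in> Hom C P M" "monic C \<iota>" "im \<iota> = im \<gamma> \<inter> im \<delta>"
    using intersection_subobject[OF \<gamma> \<delta>] by blast
  obtain \<alpha> where \<alpha>: "\<alpha> \<in> Hom C P A" "\<iota> = \<gamma> \<cdot>\<^bsub>C\<^esub> \<alpha>"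
    using factor_through_monic[OF \<iota>(1) \<gamma>] \<iota>(3) by auto
  obtain \<beta> where \<beta>: "\<beta> \<in> Hom C P B" "\<iota> = \<delta> \<cdot>\<^bsub>C\<^esub> \<beta>"
    using factor_through_monic[OF \<iota>(1) \<delta>] \<iota>(3) by auto
  have "monic C \<alpha>" using monic_right_factor \<iota>(2) \<alpha> \<gamma>(1) by blast
  moreover have "monic C \<beta>" using monic_right_factor \<iota>(2) \<beta> \<delta>(1) by blast
  ultimately show ?thesis using that \<alpha> \<beta> \<iota>(3) by metis
qed

text \<open>
  A complement of \<open>A \<inter> B\<close> in \<open>A\<close> is the intersection of \<open>A\<close> with a complement of \<open>B\<close> in \<open>M\<close>.
\<close>

lemma coproduct_injection_restrict:
  assumes \<gamma>: "\<gamma> \<in> Hom C A M" "monic C \<gamma>"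
    and \<delta>: "\<delta> \<in> Hom C B M" "\<delta> \<in> coproduct_injections \<S> C"
    and \<alpha>: "\<alpha> \<in> Hom C P A" "monic C \<alpha>" "im (\<gamma> \<cdot>\<^bsub>C\<^esub> \<alpha>) = im \<gamma> \<inter> im \<delta>"
  shows "\<alpha> \<in> coproduct_injections \<S> C"
proof -
  obtain B' \<delta>' where c: "binary_coproduct C B B' M \<delta> \<delta>'"
    using coproduct_injection_complement[OF \<delta>] .
  have "\<delta>' \<in> Hom C B' M" "monic C \<delta>'"
    using source.binary_coproduct_Hom[OF c] UD5_monic[OF c] by blast+
  then obtain P' \<alpha>' where "\<alpha>' \<in> Hom C P' A" "monic C \<alpha>'" "im (\<gamma> \<cdot>\<^bsub>C\<^esub> \<alpha>') = im \<gamma> \<inter> im \<delta>'"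
    using subobject_intersection_factor[OF \<gamma>] by metis
  then show ?thesis
    using subobject_restrict_coproduct[OF \<gamma> c \<alpha>(1,3,2)] unfolding coproduct_injections_iff by blast
qed

lemma M_pullback_exists:
  assumes \<gamma>: "\<gamma> \<in> Hom C A M" "\<gamma> \<in> coproduct_injections \<S> C"
    and \<delta>: "\<delta> \<in> Hom C B M" "\<delta> \<in> coproduct_injections \<S> C"
  shows "\<exists>P \<alpha> \<beta>. M_pullback \<S> C P A B M \<alpha> \<beta> \<gamma> \<delta>"
proof -
  note m = coproduct_injection_monic[OF \<gamma>(2)] coproduct_injection_monic[OF \<delta>(2)]
  obtain P \<alpha> \<beta> where P: "\<alpha> \<in> Hom C P A" "monic C \<alpha>" "\<beta> \<in> Hom C P B" "monic C \<beta>"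
    "\<gamma> \<cdot>\<^bsub>C\<^esub> \<alpha> = \<delta> \<cdot>\<^bsub>C\<^esub> \<beta>" "im (\<gamma> \<cdot>\<^bsub>C\<^esub> \<alpha>) = im \<gamma> \<inter> im \<delta>"
    using subobject_intersection_factor[OF \<gamma>(1) m(1) \<delta>(1) m(2)] .
  have "is_pullback C P A B M \<alpha> \<beta> \<gamma> \<delta>"
    using pullback_iff_im[OF P(1-3) \<gamma>(1) m(1) \<delta>(1) m(2) P(5)] P(6) by simp
  moreover have "\<alpha> \<in> coproduct_injections \<S> C"
    using coproduct_injection_restrict[OF \<gamma>(1) m(1) \<delta> P(1,2,6)] .
  moreover have "\<beta> \<in> coproduct_injections \<S> C"
    using coproduct_injection_restrict[OF \<delta>(1) m(2) \<gamma> P(3,4)] P(5,6) by (simp add: Int_commute)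
  ultimately show ?thesis unfolding M_pullback_def by blast
qed

text \<open>
  The square is a pull-back because a point of \<open>A\<close> lying over \<open>B1\<close> but coming from \<open>P2\<close> also lies over \<open>B2\<close>, hence comes from the
  initial object and therefore from \<open>P1\<close> after all.
\<close>

lemma coproduct_square_pullback:
  assumes c: "binary_coproduct C B1 B2 Q \<iota>1 \<iota>2" and d: "binary_coproduct C P1 P2 A p1 p2"
    and v1: "v1 \<in> Hom C P1 B1" "v1 \<in> coproduct_injections \<S> C"
    and v: "v \<in> Hom C A Q" "monic C v" and v2: "v2 \<in> Hom C P2 B2"
    and comm: "v \<cdot>\<^bsub>C\<^esub> p1 = \<iota>1 \<cdot>\<^bsub>C\<^esub> v1" "v \<cdot>\<^bsub>C\<^esub> p2 = \<iota>2 \<cdot>\<^bsub>C\<^esub> v2"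
  shows "M_pullback \<S> C P1 A B1 Q p1 v1 v \<iota>1"
proof -
  note \<iota> = source.binary_coproduct_Hom[OF c] and p = source.binary_coproduct_Hom[OF d]
  obtain \<theta> where \<theta>: "initial C \<theta>" using UD1_initial by blast
  obtain z where z: "z \<in> Hom C \<theta> Q"
    using source.initial_Hom[OF \<theta> source.Hom_Obj(2)[OF v(1)]] .
  have "im v \<inter> im \<iota>1 \<subseteq> im (v \<cdot>\<^bsub>C\<^esub> p1)"
  proof
    fix y assume y: "y \<in> im v \<inter> im \<iota>1"
    have "im v = im (v \<cdot>\<^bsub>C\<^esub> p1) \<union> im (v \<cdot>\<^bsub>C\<^esub> p2)"
      unfolding im_Comp[OF p(1) v(1)] im_Comp[OF p(2) v(1)] im_Hom[OF v(1)]
      using binary_coproduct_cover[OF d] by (metis image_Un)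
    then consider "y \<in> im (v \<cdot>\<^bsub>C\<^esub> p1)" | "y \<in> im (v \<cdot>\<^bsub>C\<^esub> p2)" using y by blast
    then show "y \<in> im (v \<cdot>\<^bsub>C\<^esub> p1)"
    proof cases
      case 2
      then have "y \<in> im \<iota>1 \<inter> im \<iota>2" using y comm(2) im_Comp_subset[OF v2 \<iota>(2)] by auto
      then show ?thesis
        using binary_coproduct_meet[OF c \<theta> z]
          im_initial_subset[OF \<theta> z source.Comp_in_Hom[OF p(1) v(1)]] by blast
    qed
  qed
  then have "is_pullback C P1 A B1 Q p1 v1 v \<iota>1"
    using pullback_iff_im[OF p(1) _ v1(1) v \<iota>(1) _ comm(1)] UD5_monic[OF c] UD5_monic[OF d] by blast
  moreover have "p1 \<in> coproduct_injections \<S> C"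
    using d unfolding coproduct_injections_iff by blast
  ultimately show ?thesis using v1(2) unfolding M_pullback_def by blast
qed

lemma M_pullback_coproduct:
  assumes c: "binary_coproduct C B1 B2 Q \<iota>1 \<iota>2" and v: "v \<in> Hom C A Q" "monic C v"
    and pb: "M_pullback \<S> C P1 A B1 Q p1 v1 v \<iota>1" "M_pullback \<S> C P2 A B2 Q p2 v2 v \<iota>2"
  shows "binary_coproduct C P1 P2 A p1 p2"
proof -
  note \<iota> = source.binary_coproduct_Hom[OF c]
  have im_eq: "p \<in> Hom C P A \<and> monic C p \<and> im (v \<cdot>\<^bsub>C\<^esub> p) = im v \<inter> im \<iota>"
    if "M_pullback \<S> C P A B Q p w v \<iota>" "monic C \<iota>" for P B p w \<iota>
  proof -
    have pb: "is_pullback C P A B Q p w v \<iota>" and p: "monic C p"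
      using that(1) coproduct_injection_monic unfolding M_pullback_def by blast+
    then have H: "p \<in> Hom C P A" "w \<in> Hom C P B" "\<iota> \<in> Hom C B Q" "v \<cdot>\<^bsub>C\<^esub> p = \<iota> \<cdot>\<^bsub>C\<^esub> w"
      unfolding is_pullback_def by blast+
    have "im v \<inter> im \<iota> \<subseteq> im (v \<cdot>\<^bsub>C\<^esub> p)"
      using pullback_iff_im[OF H(1) p H(2) v H(3) that(2) H(4)] pb by blast
    moreover have "im (v \<cdot>\<^bsub>C\<^esub> p) \<subseteq> im v \<inter> im \<iota>"
      using im_Comp_subset[OF H(1) v(1)] im_Comp_subset[OF H(2,3)] H(4) by auto
    ultimately show ?thesis using H(1) p by blast
  qed
  show ?thesis
    using im_eq[OF pb(1)] im_eq[OF pb(2)] UD5_monic[OF c]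
    by (intro subobject_restrict_coproduct[OF v c]) blast+
qed

end

theorem proposition3p12:
  fixes \<S> :: "'u set set"
    and C :: "('o, 'm) cat"
    and U :: "('o, 'm, 'u set, 'u set \<times> ('u \<Rightarrow> 'u) \<times> 'u set) cat_map"
  assumes "UD_category \<S> C U"
  shows "mono_extensive \<S> C"
proof -
  interpret UD_category \<S> C U by (fact assms)
  show ?thesis
    unfolding mono_extensive_def mono_extensive_object_def
  proof (intro ballI conjI allI impI)
    fix M A B \<gamma> \<delta>
    assume "\<gamma> \<in> Hom C A M \<inter> coproduct_injections \<S> C" "\<delta> \<in> Hom C B M \<inter> coproduct_injections \<S> C"
    then show "\<exists>P \<alpha> \<beta>. M_pullback \<S> C P A B M \<alpha> \<beta> \<gamma> \<delta>"
      using M_pullback_exists by blast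
  next
    fix M B1 B2 Q \<iota>1 \<iota>2 P1 A P2 p1 p2 v1 v v2
    assume "binary_coproduct C B1 B2 Q \<iota>1 \<iota>2 \<and> isomorphic C M Q"
      and v1: "v1 \<in> Hom C P1 B1 \<inter> coproduct_injections \<S> C"
      and v: "v \<in> Hom C A Q \<inter> coproduct_injections \<S> C"
      and v2: "v2 \<in> Hom C P2 B2 \<inter> coproduct_injections \<S> C"
      and comm: "v \<cdot>\<^bsub>C\<^esub> p1 = \<iota>1 \<cdot>\<^bsub>C\<^esub> v1 \<and> v \<cdot>\<^bsub>C\<^esub> p2 = \<iota>2 \<cdot>\<^bsub>C\<^esub> v2"
    then have c: "binary_coproduct C B1 B2 Q \<iota>1 \<iota>2" and m: "monic C v"
      using coproduct_injection_monic by blast+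
    show "binary_coproduct C P1 P2 A p1 p2 \<longleftrightarrow>
        M_pullback \<S> C P1 A B1 Q p1 v1 v \<iota>1 \<and> M_pullback \<S> C P2 A B2 Q p2 v2 v \<iota>2"
    proof
      assume d: "binary_coproduct C P1 P2 A p1 p2"
      show "M_pullback \<S> C P1 A B1 Q p1 v1 v \<iota>1 \<and> M_pullback \<S> C P2 A B2 Q p2 v2 v \<iota>2"
        using coproduct_square_pullback[OF c d] v1 v v2 m comm
          coproduct_square_pullback[OF source.binary_coproduct_commute[OF c]
            source.binary_coproduct_commute[OF d]]
        by blast
    qed (use M_pullback_coproduct[OF c] v m in blast)
  qed
qed

end
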